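(* Let $k\in\mathbb{Z}$, let $a\in\mathbb{C}$ with $a\neq 0$, and let $n\ge 0$. Then \[ PC_{n}^{(k)}(x:a)=\sum_{l=0}^{n}\binom{n}{l}\frac{(-1)^{n-l}}{a^{l}}\,C_{l}^{(k)}(x). \]
   Context: For an integer $k$, $\mathrm{Lif}_k(t)=\sum_{n=0}^{\infty}\frac{t^{n}}{n!\,(n+1)^{k}}$ (a formal power series). The poly-Cauchy polynomials of the first kind $C_n^{(k)}(x)$ are defined by $\frac{1}{(1+t)^{x}}\mathrm{Lif}_k(\log(1+t))=\sum_{n\ge0}C_n^{(k)}(x)\frac{t^n}{n!}$. For $a\neq0$, the Poisson-Charlier and poly-Cauchy of the first kind mixed type polynomials $PC_n^{(k)}(x:a)$ are defined by $e^{-t}\,\mathrm{Lif}_k\!\left(\log\left(1+\frac{t}{a}\right)\right)\left(1+\frac{t}{a}\right)^{-x}=\sum_{n\ge0}PC_n^{(k)}(x:a)\frac{t^n}{n!}$. *)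

theory Defs
  imports Complex_Main "HOL-Computational_Algebra.Formal_Power_Series"
begin

definition Lif :: "int \<Rightarrow> complex fps" where
  "Lif k = Abs_fps (\<lambda>n. 1 / (fact n * (of_nat n + 1) powi k))"

text \<open>
  As formal power series in $t$: \<^term>\<open>fps_binomial x\<close> is $(1+t)^x$, \<^term>\<open>fps_ln 1\<close> is
  $\log(1+t)$, and composing with \<^term>\<open>fps_const (1 / a) * fps_X\<close> substitutes $t/a$ for $t$.
\<close>

definition poly_Cauchy_gf :: "int \<Rightarrow> complex \<Rightarrow> complex fps" where
  "poly_Cauchy_gf k x = inverse (fps_binomial x) * (Lif k oo fps_ln 1)"

definition poly_Cauchy :: "int \<Rightarrow> nat \<Rightarrow> complex \<Rightarrow> complex" where
  "poly_Cauchy k n x = fact n * fps_nth (poly_Cauchy_gf k x) n"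

definition PC_gf :: "int \<Rightarrow> complex \<Rightarrow> complex \<Rightarrow> complex fps" where
  "PC_gf k a x =
     fps_exp (-1) * (Lif k oo (fps_ln 1 oo (fps_const (1 / a) * fps_X)))
       * (fps_binomial (- x) oo (fps_const (1 / a) * fps_X))"

definition PC :: "int \<Rightarrow> nat \<Rightarrow> complex \<Rightarrow> complex \<Rightarrow> complex" where
  "PC k n x a = fact n * fps_nth (PC_gf k a x) n"

lemma poly_Cauchy_generating_function:
  "inverse (fps_binomial x) * (Lif k oo fps_ln 1) = Abs_fps (\<lambda>n. poly_Cauchy k n x / fact n)"
  by (simp add: fps_eq_iff poly_Cauchy_def poly_Cauchy_gf_def)

lemma PC_generating_function:
  "fps_exp (-1) * (Lif k oo (fps_ln 1 oo (fps_const (1 / a) * fps_X)))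
     * (fps_binomial (- x) oo (fps_const (1 / a) * fps_X)) = Abs_fps (\<lambda>n. PC k n x a / fact n)"
  by (simp add: fps_eq_iff PC_def PC_gf_def)

end

theory Submission
  imports Defs
begin

text \<open>The generating function of \<open>PC\<close> is that of \<open>poly_Cauchy\<close> with
  t/a in place of t, times e^(-t) (\<open>PC_gf_eq\<close>); the claim compares coefficients in this
  product.\<close>

lemma inverse_fps_binomial:
  "inverse (fps_binomial (x :: 'a :: field_char_0)) = fps_binomial (- x)"
  by (rule fps_inverse_unique) (simp flip: fps_binomial_add_mult)

text \<open>Substituting t/a respects products and nested composition. With the exponential on the
  right, the summation index of the Cauchy product falls on the poly-Cauchy factor.\<close>

lemma PC_gf_eq:
  "PC_gf k a x = (poly_Cauchy_gf k x oo (fps_const (1 / a) * fps_X)) * fps_exp (- 1)"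
  by (simp add: PC_gf_def poly_Cauchy_gf_def inverse_fps_binomial fps_compose_mult_distrib
      fps_compose_assoc mult_ac)

theorem theorem1:
  fixes k :: int and a x :: complex and n :: nat
  assumes "a \<noteq> 0"
  shows "PC k n x a =
    (\<Sum>l=0..n. of_nat (n choose l) * ((- 1) ^ (n - l) / a ^ l) * poly_Cauchy k l x)"
  unfolding PC_def PC_gf_eq fps_mult_nth fps_nth_compose_linear sum_distrib_left
  \<comment> \<open>In each term, n! from \<open>PC\<close>, 1/l! from \<open>poly_Cauchy\<close>
    and 1/(n-l)! from e^(-t) combine to the binomial coefficient.\<close>
  by (intro sum.cong)
    (auto simp: poly_Cauchy_def binomial_fact power_divide field_simps)

end
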